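(* Let $u,w\in\mathfrak{W}_n$. If $\mathcal{Q}(u)=\mathcal{Q}(w)$, then $u\sim_{cd}w$.
   Context: $\mathfrak{W}_n$: words of length $n$ in positive integers. For a word $x$, $\mathrm{lds}(x)$ is the length of a longest strictly decreasing subsequence; $u\sim_{cd}w$ means $\mathrm{lds}(u_i\cdots u_j)=\mathrm{lds}(w_i\cdots w_j)$ for all $1\le i\le j\le n$. iRSK: for a one-row semistandard tableau $p$ and integer $a$, $p\dashleftarrow a$ appends $a$ if $p$ is empty or $a\ge$ all entries of $p$, otherwise replaces the leftmost entry larger than $a$ by $a$ (bumping it); for a word, insert letters successively. For a semistandard tableau $P'$ with rows $p'_1,p'_2,\dots$ and positive integer $a$, $P'\twoheadleftarrow a$: adjoin a row $p'_0$ consisting of one box containing $a$, above row $1$, in the column just right of the last box of $p'_1$; $S_0=\{a\}$. Given $S_i=\{a_1<\dots<a_k\}$, let $\alpha_i^+=a_1^{m_1}\cdots a_k^{m_k}$ ($m_j\ge1$) be chosen so that in $p_{i+1}:=p'_{i+1}\dashleftarrow\alpha_i^+$ the rightmost occurrence of each $a_j$ is in the same column as the leftmost occurrence of $a_j$ in $p'_i$; $S_{i+1}$ is the set of bumped values; stop when it is empty (remaining rows unchanged). The result has rows $p_1,p_2,\dots$. $\mathcal{P}(w)=((\emptyset\twoheadleftarrow w_1)\twoheadleftarrow w_2)\cdots\twoheadleftarrow w_n$. With $\lambda^{(j)}$ the shape of $\mathcal{P}(w_1\cdots w_j)$ and $\lambda^{(0)}=\emptyset$, the i-recording tableau $\mathcal{Q}(w)$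 is the tableau of shape $\lambda^{(n)}$ with entry $j$ in each box of $\lambda^{(j)}/\lambda^{(j-1)}$, $1\le j\le n$. *)

theory Defs
  imports Main "HOL-Library.Sublist"
begin

text \<open>Words are lists of positive naturals. Positions in rows and tableaux are counted from 0.\<close>

definition words :: "nat \<Rightarrow> nat list set" where
  "words n = {w. length w = n \<and> (\<forall>a \<in> set w. 0 < a)}"

definition lds :: "nat list \<Rightarrow> nat" where
  "lds x = Max (length ` {s. subseq s x \<and> sorted_wrt (>) s})"

text \<open>The consecutive factor \<open>w\<^sub>i \<dots> w\<^sub>j\<close>, with letters numbered from 1.\<close>

definition factor :: "nat list \<Rightarrow> nat \<Rightarrow> nat \<Rightarrow> nat list" where
  "factor w i j = drop (i - 1) (take j w)"

definition cd_equiv :: "nat list \<Rightarrow> nat list \<Rightarrow> bool" (infix "\<sim>cd" 50) where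
  "u \<sim>cd w \<longleftrightarrow> length u = length w \<and>
     (\<forall>i j. 1 \<le> i \<and> i \<le> j \<and> j \<le> length u \<longrightarrow> lds (factor u i j) = lds (factor w i j))"

text \<open>A tableau is the list of its rows, top row first. The operations below are intended for
  semistandard rows and tableaux, although they are defined on all lists.\<close>

type_synonym row = "nat list"
type_synonym tableau = "row list"

definition bump_pos :: "row \<Rightarrow> nat \<Rightarrow> nat" where
  "bump_pos p a = (LEAST k. k < length p \<and> a < p ! k)"

definition row_insert :: "row \<Rightarrow> nat \<Rightarrow> row" where
  "row_insert p a = (if \<forall>x \<in> set p. x \<le> a then p @ [a] else p[bump_pos p a := a])"

definition bumped :: "row \<Rightarrow> nat \<Rightarrow> nat set" where
  "bumped p a = (if \<forall>x \<in> set p. x \<le> a then {} else {p ! bump_pos p a})"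

definition row_insert_word :: "row \<Rightarrow> nat list \<Rightarrow> row" where
  "row_insert_word p x = foldl row_insert p x"

fun bumped_word :: "row \<Rightarrow> nat list \<Rightarrow> nat set" where
  "bumped_word p [] = {}"
| "bumped_word p (a # x) = bumped p a \<union> bumped_word (row_insert p a) x"

definition leftmost :: "row \<Rightarrow> nat \<Rightarrow> nat" where
  "leftmost p a = Min {k. k < length p \<and> p ! k = a}"

definition rightmost :: "row \<Rightarrow> nat \<Rightarrow> nat" where
  "rightmost p a = Max {k. k < length p \<and> p ! k = a}"

text \<open>For \<open>S = {a\<^sub>1 < \<dots> < a\<^sub>k}\<close>, \<open>mult_word S m\<close> is the word in which each \<open>a\<^sub>j\<close> is
  repeated \<open>m a\<^sub>j\<close> times. In \<open>alpha_plus col S p\<close>, \<open>p\<close> is the row receiving the insertion and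
  \<open>col a\<close> is the column of the leftmost occurrence of \<open>a\<close> in the row above \<open>p\<close>. The description
  determines the word because each further copy of \<open>a\<^sub>j\<close> moves its rightmost occurrence one
  column to the right.\<close>

definition mult_word :: "nat set \<Rightarrow> (nat \<Rightarrow> nat) \<Rightarrow> nat list" where
  "mult_word S m = concat (map (\<lambda>a. replicate (m a) a) (sorted_list_of_set S))"

definition alpha_plus :: "(nat \<Rightarrow> nat) \<Rightarrow> nat set \<Rightarrow> row \<Rightarrow> nat list" where
  "alpha_plus col S p = (THE \<alpha>. \<exists>m. (\<forall>a \<in> S. 1 \<le> m a) \<and> \<alpha> = mult_word S m \<and>
     (\<forall>a \<in> S. rightmost (row_insert_word p \<alpha>) a = col a))"

text \<open>When letters remain to be inserted below the last row, they form a new row. No recursive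
  call is needed there: a weakly increasing word inserted into the empty row bumps nothing.\<close>

fun insert_rows :: "(nat \<Rightarrow> nat) \<Rightarrow> nat set \<Rightarrow> tableau \<Rightarrow> tableau" where
  "insert_rows col S [] = (if S = {} then [] else [row_insert_word [] (alpha_plus col S [])])"
| "insert_rows col S (p # P) =
     (if S = {} then p # P
      else row_insert_word p (alpha_plus col S p) #
           insert_rows (leftmost p) (bumped_word p (alpha_plus col S p)) P)"

text \<open>The adjoined row above the tableau has a single box, holding \<open>a\<close>, in the column just right
  of the last box of the first row (column 0 if the tableau is empty). With columns counted from
  0, that column is the length of the first row.\<close>

definition irsk_insert :: "tableau \<Rightarrow> nat \<Rightarrow> tableau" where
  "irsk_insert P a = insert_rows (\<lambda>_. case P of [] \<Rightarrow> 0 | p # _ \<Rightarrow> length p) {a} P"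

definition P_tableau :: "nat list \<Rightarrow> tableau" where
  "P_tableau w = foldl irsk_insert [] w"

text \<open>Shapes are Young diagrams, as sets of (row, column) boxes, so that a skew shape is a set
  difference.\<close>

definition shape :: "tableau \<Rightarrow> (nat \<times> nat) set" where
  "shape P = {(r, c). r < length P \<and> c < length (P ! r)}"

definition prefix_shape :: "nat list \<Rightarrow> nat \<Rightarrow> (nat \<times> nat) set" where
  "prefix_shape w j = shape (P_tableau (take j w))"

text \<open>The i-recording tableau, as a filling of the boxes of its shape, which is its domain.\<close>

definition Q_tableau :: "nat list \<Rightarrow> (nat \<times> nat \<rightharpoonup> nat)" where
  "Q_tableau w b =
     (if b \<in> prefix_shape w (length w)
      then Some (THE j. 1 \<le> j \<and> j \<le> length w \<and> b \<in> prefix_shape w j - prefix_shape w (j - 1))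
      else None)"

end

(* Within one step, the words entering and leaving a row are weakly increasing, so only their
   letters matter for decreasing subsequences; the multiplicities, hence the columns, do not. Each
   row then performs ordinary row insertion, for which lds (a x) = 1 + lds (bumped letters of x)
   when the row ends with its maximum a. Applied with a sentinel a above all letters, this says: if
   row r first grows at time t of a time interval, the lds of the letters entering row r in that
   interval is the maximum of the lds of the letters entering row r + 1 and 1 + the lds of those
   entering row r + 1 after t; if it does not grow, the two lds agree. By downward induction on r
   the shapes, hence the recording tableau, determine the lds of every factor. *)

theory Submission
  imports Defs
begin

section \<open>Longest decreasing subsequences\<close>

text \<open>A factor starts in the middle of the word, when the rows already hold letters that may
  differ between the two words, so a count of rows grown from the empty tableau says nothing about
  it. The sentinel removes this dependence: put in front of the inserted letters it raises their
  \<open>lds\<close> by exactly one, and put at the end of a row it does not disturb insertion until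
  the first letter that would have been appended bumps it instead. From then on the row is the true
  one and later growth leaves no trace, which is why only the first growth in the interval enters
  the recursion. The bumped sentinel can head any decreasing subsequence of the letters bumped
  afterwards; this is the term with \<open>Suc\<close>. The other obstacle is the definite
  description in \<open>alpha_plus\<close>, which says nothing unless the prescribed columns can be
  reached. Semistandardness is therefore carried along as an invariant: strictness of columns leaves
  room for at least one copy of each bumped letter, and the prescribed columns in turn restore that
  strictness. Once the words exist, their columns are forgotten.\<close>

lemma lds_finite: "finite (length ` {s. subseq s x \<and> sorted_wrt (>) s})"
proof -
  have "{s. subseq s x \<and> sorted_wrt (>) s} \<subseteq> set (subseqs x)"
    by auto
  then show ?thesis
    using finite_subset by blast
qed

lemma lds_ge: "subseq s x \<Longrightarrow> sorted_wrt (>) s \<Longrightarrow> length s \<le> lds x"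
  unfolding lds_def using lds_finite by (intro Max_ge) auto

lemma lds_witness:
  obtains s where "subseq s x" "sorted_wrt (>) s" "length s = lds x"
proof -
  have "lds x \<in> length ` {s. subseq s x \<and> sorted_wrt (>) s}"
    unfolding lds_def by (rule Max_in[OF lds_finite]) (auto intro: exI[of _ "[]"])
  then show ?thesis
    using that by auto
qed

lemma lds_transfer:
  assumes "\<And>s. subseq s x \<Longrightarrow> sorted_wrt (>) s \<Longrightarrow> subseq s y"
  shows "lds x \<le> lds y"
proof -
  obtain s where "subseq s x" "sorted_wrt (>) s" "length s = lds x"
    by (rule lds_witness)
  then show ?thesis
    using assms lds_ge by metis
qed

lemma lds_mono: "subseq x y \<Longrightarrow> lds x \<le> lds y"
  by (rule lds_transfer) (rule subseq_order.order_trans)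

lemma lds_Nil [simp]: "lds [] = 0"
  by (rule lds_witness[of "[]"]) (auto dest: list_emb_Nil2)

text \<open>A decreasing subsequence either avoids the head or continues below it. Identities
  between \<open>lds\<close> values thereby reduce to arithmetic with \<open>max\<close>, which is
  how the bumping recursion is checked.\<close>

lemma lds_Cons: "lds (a # x) = max (lds x) (Suc (lds (filter (\<lambda>b. b < a) x)))"
proof (rule antisym)
  obtain s where s: "subseq s (a # x)" "sorted_wrt (>) s" "length s = lds (a # x)"
    by (rule lds_witness)
  show "lds (a # x) \<le> max (lds x) (Suc (lds (filter (\<lambda>b. b < a) x)))"
  proof (cases "subseq s x")
    case True
    then show ?thesis
      using lds_ge s by fastforce
  next
    case False
    then obtain s' where s': "s = a # s'" "subseq s' x"
      using s(1) by (cases s) (auto simp: subseq_Cons2_iff split: if_splits)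
    then have "filter (\<lambda>b. b < a) s' = s'"
      using s(2) by (simp add: filter_id_conv)
    then have "subseq s' (filter (\<lambda>b. b < a) x)"
      using subseq_filter[OF s'(2), of "\<lambda>b. b < a"] by simp
    then have "length s' \<le> lds (filter (\<lambda>b. b < a) x)"
      using s(2) s'(1) lds_ge by auto
    then show ?thesis
      using s(3) s'(1) by simp
  qed
  obtain s where s: "subseq s (filter (\<lambda>b. b < a) x)" "sorted_wrt (>) s"
    "length s = lds (filter (\<lambda>b. b < a) x)"
    by (rule lds_witness)
  have "\<forall>b \<in> set s. b < a"
    using s(1) by (auto elim: list_emb_set)
  moreover have "subseq s x"
    by (rule subseq_order.order_trans[OF s(1) subseq_filter_left])
  ultimately have "Suc (length s) \<le> lds (a # x)"
    using lds_ge[of "a # s" "a # x"] s(2) by simp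
  moreover have "lds x \<le> lds (a # x)"
    by (intro lds_mono list_emb_Cons) simp
  ultimately show "max (lds x) (Suc (lds (filter (\<lambda>b. b < a) x))) \<le> lds (a # x)"
    using s(3) by simp
qed

text \<open>A letter above all others can only head a decreasing subsequence, so only
  \<open>y\<close> can follow it. This evaluates the sequence of bumped letters with the sentinel in
  its midst.\<close>

lemma lds_insert_max:
  assumes "\<forall>b \<in> set x \<union> set y. b < M"
  shows "lds (x @ M # y) = max (lds (x @ y)) (Suc (lds y))"
  using assms
proof (induction x)
  case Nil
  then have "filter (\<lambda>b. b < M) y = y"
    by (simp add: filter_id_conv)
  then show ?case
    by (simp add: lds_Cons)
next
  case (Cons a x)
  have "filter (\<lambda>b. b < a) (x @ M # y) = filter (\<lambda>b. b < a) (x @ y)"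
    using Cons.prems by auto
  then show ?case
    using Cons unfolding append_Cons lds_Cons[of a] by simp
qed

text \<open>A strictly decreasing sequence meets each weakly increasing block at most once.\<close>

lemma lds_concat_cong:
  assumes "list_all2 (\<lambda>x y. sorted x \<and> sorted y \<and> set x = set y) xs ys"
  shows "lds (concat xs) = lds (concat ys)"
proof -
  have sub: "subseq s (concat ys)"
    if "list_all2 (\<lambda>x y. sorted x \<and> sorted y \<and> set x = set y) xs ys"
      "subseq s (concat xs)" "sorted_wrt (>) s" for s and xs ys :: "nat list list"
    using that
  proof (induction arbitrary: s rule: list_all2_induct)
    case Nil
    then show ?case by simp
  next
    case (Cons x xs y ys)
    obtain s1 s2 where s: "s = s1 @ s2" "subseq s1 x" "subseq s2 (concat xs)"
      using Cons.prems(1) by (auto elim: subseq_appendE)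
    have "sorted s1"
      using Cons.hyps(1) s(2) by (auto simp: subseq_conv_nths sorted_nths)
    moreover have "sorted_wrt (>) s1"
      using Cons.prems(2) s(1) by (simp add: sorted_wrt_append)
    ultimately have "s1 = [] \<or> (\<exists>v. s1 = [v])"
      by (cases s1 rule: remdups_adj.cases) auto
    then have "subseq s1 y"
      using s(2) Cons.hyps(1) by (auto simp: subseq_singleton_left)
    moreover have "subseq s2 (concat ys)"
      using Cons s by (simp add: sorted_wrt_append)
    ultimately show ?case
      by (simp add: s(1) list_emb_append_mono)
  qed
  have flip: "list_all2 (\<lambda>x y. sorted x \<and> sorted y \<and> set x = set y) ys xs"
    using assms by (auto simp: list_all2_conv_all_nth)
  show ?thesis
    using sub[OF assms] sub[OF flip] by (intro antisym lds_transfer) auto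
qed

section \<open>Row insertion\<close>

text \<open>The letter of \<open>bumped\<close>, kept as a list of length at most one: the order in
  which letters leave a row matters for \<open>lds\<close>, and a set loses it.\<close>

definition bump :: "row \<Rightarrow> nat \<Rightarrow> nat list" where
  "bump p a = (if \<forall>x \<in> set p. x \<le> a then [] else [p ! bump_pos p a])"

fun bump_word :: "row \<Rightarrow> nat list \<Rightarrow> nat list" where
  "bump_word p [] = []"
| "bump_word p (a # x) = bump p a @ bump_word (row_insert p a) x"

lemma bump_pos:
  assumes "\<not> (\<forall>x \<in> set p. x \<le> a)"
  shows "bump_pos p a < length p" "a < p ! bump_pos p a" "i < bump_pos p a \<Longrightarrow> p ! i \<le> a"
proof -
  have ex: "\<exists>k. k < length p \<and> a < p ! k"
    using assms by (auto simp: in_set_conv_nth not_le)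
  show *: "bump_pos p a < length p" "a < p ! bump_pos p a"
    using LeastI_ex[OF ex] by (auto simp: bump_pos_def)
  show "p ! i \<le> a" if "i < bump_pos p a"
    using that not_less_Least[of i "\<lambda>k. k < length p \<and> a < p ! k"] *(1)
    by (auto simp: bump_pos_def not_less)
qed

lemma bump_pos_eqI:
  assumes "k < length p" "a < p ! k" "\<And>i. i < k \<Longrightarrow> p ! i \<le> a"
  shows "bump_pos p a = k"
  unfolding bump_pos_def using assms by (intro Least_equality) (auto simp: not_less[symmetric])

lemma bump_pos_Cons:
  assumes "b \<le> a" "\<not> (\<forall>x \<in> set p. x \<le> a)"
  shows "bump_pos (b # p) a = Suc (bump_pos p a)"
  using bump_pos[OF assms(2)] assms(1) by (intro bump_pos_eqI) (auto simp: nth_Cons split: nat.split)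

lemma bump_pos_Cons_0: "a < b \<Longrightarrow> bump_pos (b # p) a = 0"
  by (rule bump_pos_eqI) auto

lemma row_insert_Nil [simp]: "row_insert [] a = [a]"
  by (simp add: row_insert_def)

text \<open>Trades the least-index definition for recursion along the row; together with
  \<open>bump_Cons\<close> it makes most facts about insertion structural inductions.\<close>

lemma row_insert_Cons [simp]:
  "row_insert (b # p) a = (if b \<le> a then b # row_insert p a else a # p)"
  by (auto simp: row_insert_def bump_pos_Cons bump_pos_Cons_0 not_le)

lemma bump_Nil [simp]: "bump [] a = []"
  by (simp add: bump_def)

lemma bump_Cons [simp]: "bump (b # p) a = (if b \<le> a then bump p a else [b])"
  by (auto simp: bump_def bump_pos_Cons bump_pos_Cons_0 not_le)

lemma set_bump: "set (bump p a) = bumped p a"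
  by (simp add: bump_def bumped_def)

lemma set_bump_word: "set (bump_word p x) = bumped_word p x"
  by (induction x arbitrary: p) (auto simp: set_bump)

lemma row_insert_word_Nil [simp]: "row_insert_word p [] = p"
  by (simp add: row_insert_word_def)

lemma row_insert_word_Cons [simp]:
  "row_insert_word p (a # x) = row_insert_word (row_insert p a) x"
  by (simp add: row_insert_word_def)

lemma row_insert_word_append:
  "row_insert_word p (x @ y) = row_insert_word (row_insert_word p x) y"
  by (simp add: row_insert_word_def)

lemma bump_word_append:
  "bump_word p (x @ y) = bump_word p x @ bump_word (row_insert_word p x) y"
  by (induction x arbitrary: p) auto

lemma set_row_insert: "set (row_insert p a) \<subseteq> insert a (set p)"
  by (induction p) auto

lemma sorted_row_insert: "sorted p \<Longrightarrow> sorted (row_insert p a)"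
  by (induction p) (use set_row_insert in fastforce)+

lemma sorted_row_insert_word: "sorted p \<Longrightarrow> sorted (row_insert_word p x)"
  by (induction x arbitrary: p) (auto simp: sorted_row_insert)

lemma set_row_insert_word: "set (row_insert_word p x) \<subseteq> set p \<union> set x"
  by (induction x arbitrary: p) (use set_row_insert in fastforce)+

lemma bump_gt: "v \<in> set (bump p a) \<Longrightarrow> v \<in> set p \<and> a < v"
  by (induction p) (auto split: if_splits)

lemma bump_word_gt: "v \<in> set (bump_word p x) \<Longrightarrow> \<exists>b \<in> set x. b < v"
  by (induction x arbitrary: p) (use bump_gt in fastforce)+

lemma set_bump_word_subset: "set (bump_word p x) \<subseteq> set p \<union> set x"
proof (induction x arbitrary: p)
  case (Cons a x)
  then show ?case
    using Cons[of "row_insert p a"] set_row_insert[of p a] bump_gt[of _ p a] by auto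
qed simp

lemma length_row_insert: "length p \<le> length (row_insert p a)"
  by (induction p) auto

lemma row_insert_nth_le: "i < length p \<Longrightarrow> row_insert p a ! i \<le> p ! i"
  by (induction p arbitrary: i) (auto simp: nth_Cons split: nat.split)

lemma length_row_insert_word: "length p \<le> length (row_insert_word p x)"
  by (induction x arbitrary: p) (auto intro: order_trans[OF length_row_insert])

lemma row_insert_word_nth_le: "i < length p \<Longrightarrow> row_insert_word p x ! i \<le> p ! i"
proof (induction x arbitrary: p)
  case (Cons a x)
  have "i < length (row_insert p a)"
    using Cons.prems length_row_insert order_less_le_trans by blast
  then show ?case
    using Cons.IH[of "row_insert p a"] row_insert_nth_le[OF Cons.prems, of a] by simp
qed simp

lemma row_insert_nth_cases:
  "i < length (row_insert p a) \<Longrightarrow> row_insert p a ! i = a \<or> i < length p \<and> row_insert p a ! i = p ! i"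
  by (induction p arbitrary: i) (auto simp: nth_Cons split: nat.splits if_splits)

lemma row_insert_word_nth_cases:
  "i < length (row_insert_word p x) \<Longrightarrow>
     row_insert_word p x ! i \<in> set x \<or> i < length p \<and> row_insert_word p x ! i = p ! i"
proof (induction x arbitrary: p)
  case (Cons a x)
  then show ?case
    using row_insert_nth_cases[of i p a] by fastforce
qed simp

section \<open>Restriction of row insertion to the letters below a bound\<close>

lemma filter_less_row_insert:
  assumes "sorted p"
  shows "filter (\<lambda>b. b < y) (row_insert p a) =
    (if a < y then row_insert (filter (\<lambda>b. b < y) p) a else filter (\<lambda>b. b < y) p)"
  using assms
proof (induction p)
  case (Cons b p)
  have "filter (\<lambda>b. b < y) p = []" if "\<not> b < y"
    using that Cons.prems by (auto simp: filter_empty_conv)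
  then show ?case
    using Cons by auto
qed auto

lemma filter_less_bump:
  assumes "sorted p"
  shows "filter (\<lambda>b. b < y) (bump p a) = (if a < y then bump (filter (\<lambda>b. b < y) p) a else [])"
  using assms
proof (induction p)
  case (Cons b p)
  have "filter (\<lambda>b. b < y) p = []" if "\<not> b < y"
    using that Cons.prems by (auto simp: filter_empty_conv)
  then show ?case
    using Cons by auto
qed auto

text \<open>Letters at least \<open>y\<close> replace only entries above \<open>y\<close>, and a
  letter below \<open>y\<close> treats the first entry that is at least \<open>y\<close> like the
  end of the row. Hence the small letters evolve as if the large ones were absent.\<close>

lemma filter_less_bump_word:
  "sorted p \<Longrightarrow> filter (\<lambda>b. b < y) (bump_word p x) =
     bump_word (filter (\<lambda>b. b < y) p) (filter (\<lambda>b. b < y) x)"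
  by (induction x arbitrary: p)
    (auto simp: filter_less_bump filter_less_row_insert sorted_row_insert)

lemma row_insert_ge: "\<forall>x \<in> set p. x \<le> a \<Longrightarrow> row_insert p a = p @ [a]"
  by (simp add: row_insert_def)

lemma bump_ge: "\<forall>x \<in> set p. x \<le> a \<Longrightarrow> bump p a = []"
  by (simp add: bump_def)

lemma bump_word_ge:
  "sorted x \<Longrightarrow> \<forall>a \<in> set p. \<forall>b \<in> set x. a \<le> b \<Longrightarrow> bump_word p x = []"
  by (induction x arbitrary: p) (auto simp: bump_ge row_insert_ge)

text \<open>This is Schensted's theorem for the word \<open>p @ a # x\<close>: inserting
  \<open>p @ [a]\<close> into the empty row bumps nothing, the bumped letters build the rows below
  the first, and \<open>lds\<close> counts rows. Any letter of \<open>p\<close> heading a decreasing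
  subsequence can be replaced by \<open>a\<close>, so \<open>p\<close> does not show on the left.
  The induction is on length because one appeal to the hypothesis concerns a filtered list.\<close>

lemma lds_Cons_bump_word:
  "sorted (p @ [a]) \<Longrightarrow> lds (a # x) = Suc (lds (bump_word (p @ [a]) x))"
proof (induction x arbitrary: p a rule: length_induct)
  case (1 x)
  note IH = "1.IH"[rule_format]
  show ?case
  proof (cases x)
    case Nil
    then show ?thesis by (simp add: lds_Cons)
  next
    case (Cons b z)
    let ?f = "\<lambda>c. filter (\<lambda>b. b < c) z"
    have mono: "lds (?f c) \<le> lds (?f d)" if "c \<le> d" for c d
    proof -
      have "?f c = filter (\<lambda>b. b < c) (?f d)"
        using that by (auto intro!: filter_cong)
      then show ?thesis
        by (metis lds_mono subseq_filter_left)
    qed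
    show ?thesis
    proof (cases "a \<le> b")
      case True
      have all: "\<forall>c \<in> set (p @ [a]). c \<le> b"
        using "1.prems" True by (auto simp: sorted_append)
      have "lds (b # z) = Suc (lds (bump_word ((p @ [a]) @ [b]) z))"
        using "1.prems" all Cons by (intro IH) (auto simp: sorted_append)
      \<comment> \<open>A decreasing subsequence headed by \<open>a\<close> can be headed by
        \<open>b\<close> instead.\<close>
      moreover have "lds (a # b # z) = lds (b # z)"
        using True mono[OF True] by (simp add: lds_Cons)
      ultimately show ?thesis
        using Cons all by (simp add: row_insert_ge bump_ge)
    next
      case False
      have nall: "\<not> (\<forall>c \<in> set (p @ [a]). c \<le> b)"
        using False by auto
      define k where "k = bump_pos (p @ [a]) b"
      define y where "y = (p @ [a]) ! k"
      define q where "q = row_insert (p @ [a]) b"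
      note k = bump_pos[OF nall, folded k_def]
      have q: "q = (p @ [a])[k := b]"
        unfolding q_def row_insert_def k_def using nall by (simp only: if_False)
      have "sorted q"
        unfolding q_def using "1.prems" by (rule sorted_row_insert)
      have bump: "bump_word (p @ [a]) x = y # bump_word q z"
        using nall Cons by (simp add: bump_def y_def k_def q_def)
      have "b < y"
        using k(2) y_def by simp
      have "y \<le> a"
      proof -
        have "y \<in> set (p @ [a])"
          using k(1) y_def by (metis nth_mem)
        then show ?thesis
          using "1.prems" by (auto simp: sorted_append)
      qed
      have qk: "q = take k (p @ [a]) @ b # drop (Suc k) (p @ [a])"
        using k(1) by (simp add: q upd_conv_take_nth_drop)
      have "sorted (take k (p @ [a]) @ y # drop (Suc k) (p @ [a]))"
        using "1.prems" k(1) unfolding y_def by (metis id_take_nth_drop)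
      then have "\<forall>c \<in> set (drop (Suc k) (p @ [a])). y \<le> c"
        by (simp add: sorted_append del: take_append drop_append)
      moreover have "\<forall>c \<in> set (take k (p @ [a])). c \<le> b"
        using k(1,3) by (auto simp: in_set_conv_nth simp del: take_append)
      ultimately have "filter (\<lambda>c. c < y) (take k (p @ [a])) = take k (p @ [a])"
        "filter (\<lambda>c. c < y) (drop (Suc k) (p @ [a])) = []"
        using \<open>b < y\<close> by (fastforce intro!: filter_True filter_False)+
      \<comment> \<open>Cut off below the bumped letter \<open>y\<close>, the new row ends with its
        maximum \<open>b\<close>; so the hypothesis applies to \<open>b\<close> followed by the
        letters of \<open>z\<close> below \<open>y\<close>.\<close>
      then have fq: "filter (\<lambda>c. c < y) q = take k (p @ [a]) @ [b]"
        using \<open>b < y\<close> unfolding qk by (simp del: take_append drop_append)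
      have sfq: "sorted (take k (p @ [a]) @ [b])"
        using \<open>sorted q\<close> unfolding fq[symmetric] by (rule sorted_filter[where f = id, simplified])
      have "lds (b # ?f y) = Suc (lds (bump_word (take k (p @ [a]) @ [b]) (?f y)))"
        using Cons sfq by (intro IH) (auto simp: less_Suc_eq_le)
      then have r: "lds (b # ?f y) = Suc (lds (filter (\<lambda>c. c < y) (bump_word q z)))"
        by (simp add: filter_less_bump_word[OF \<open>sorted q\<close>] fq)
      have fb: "filter (\<lambda>c. c < b) (?f y) = ?f b" "filter (\<lambda>c. c < b) (?f a) = ?f b"
        using \<open>b < y\<close> False by (auto intro!: filter_cong)
      define B where "B = bump_word q z"
      have 1: "Suc (lds (filter (\<lambda>c. c < y) B)) = max (lds (?f y)) (Suc (lds (?f b)))"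
        unfolding B_def r[symmetric] lds_Cons fb ..
      have 2: "lds (a # x) =
          max (max (lds z) (Suc (lds (?f b)))) (Suc (max (lds (?f a)) (Suc (lds (?f b)))))"
        using False by (simp only: Cons lds_Cons filter.simps fb not_le if_True)
      have 3: "lds (bump_word (p @ [a]) x) = max (lds B) (Suc (lds (filter (\<lambda>c. c < y) B)))"
        unfolding bump B_def lds_Cons ..
      show ?thesis
      \<comment> \<open>Either \<open>b\<close> lands before the last box and the row still ends in
        \<open>a\<close>, or \<open>a\<close> itself is bumped and the row ends in \<open>b\<close>.
        In both cases the row ends with its maximum and the hypothesis evaluates
        \<open>lds B\<close>.\<close>
      proof (cases "k < length p")
        case True
        then have "q = p[k := b] @ [a]"
          by (simp add: q list_update_append)
        then have "lds (a # z) = Suc (lds B)"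
          using IH[of z "p[k := b]" a] \<open>sorted q\<close> Cons unfolding B_def by simp
        then have "max (lds z) (Suc (lds (?f a))) = Suc (lds B)"
          unfolding lds_Cons .
        then show ?thesis
          unfolding 2 3 using 1 mono[OF \<open>y \<le> a\<close>] by linarith
      next
        case False
        then have "k = length p"
          using k(1) by simp
        then have "q = p @ [b]" "y = a"
          by (simp_all add: q y_def)
        then have "lds (b # z) = Suc (lds B)"
          using IH[of z p b] \<open>sorted q\<close> Cons unfolding B_def by simp
        then have "max (lds z) (Suc (lds (?f b))) = Suc (lds B)"
          unfolding lds_Cons .
        then show ?thesis
          unfolding 2 3 using 1 \<open>y = a\<close> by auto
      qed
    qed
  qed
qed

lemma lds_bump_word_sentinel:
  assumes "sorted p" "\<forall>b \<in> set p \<union> set x. b < M"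
  shows "lds (bump_word (p @ [M]) x) = lds x"
proof -
  have "filter (\<lambda>b. b < M) x = x"
    using assms by (simp add: filter_id_conv)
  then show ?thesis
    using lds_Cons_bump_word[of p M x] assms by (simp add: lds_Cons sorted_append less_imp_le)
qed

text \<open>A letter bumps only strictly larger ones, and the letters of \<open>x\<close> arrive in
  weakly increasing order, so nothing inserted from \<open>x\<close> leaves again.\<close>

lemma bump_word_subset:
  "sorted x \<Longrightarrow> v \<in> set (bump_word p x) \<Longrightarrow> v \<in> set p"
proof (induction x arbitrary: p)
  case (Cons a x)
  show ?case
  proof (cases "v \<in> set (bump p a)")
    case True
    then show ?thesis
      using bump_gt[of v p a] by simp
  next
    case False
    then have v: "v \<in> set (bump_word (row_insert p a) x)"
      using Cons.prems(2) by simp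
    then have "v \<in> set (row_insert p a)"
      using Cons.IH[OF _ v] Cons.prems(1) by simp
    moreover have "a < v"
      using bump_word_gt[OF v] Cons.prems(1) by auto
    ultimately show ?thesis
      using set_row_insert[of p a] by auto
  qed
qed simp

lemma bump_le:
  "sorted p \<Longrightarrow> v \<in> set (bump p a) \<Longrightarrow> c \<in> set p \<Longrightarrow> a < c \<Longrightarrow> v \<le> c"
  by (induction p) (auto split: if_splits)

text \<open>A letter bumped later already stood in \<open>p\<close> and exceeds the letters inserted
  before, so each earlier bump, taking the least larger entry, took nothing above it.\<close>

lemma sorted_bump_word: "sorted p \<Longrightarrow> sorted x \<Longrightarrow> sorted (bump_word p x)"
proof (induction x arbitrary: p)
  case (Cons a x)
  have "v \<le> c" if v: "v \<in> set (bump p a)" and c: "c \<in> set (bump_word (row_insert p a) x)" for v c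
  proof -
    have "a < c"
      using bump_word_gt[OF c] Cons.prems(2) by auto
    moreover have "c \<in> set (row_insert p a)"
      using bump_word_subset[OF _ c] Cons.prems(2) by simp
    ultimately have "c \<in> set p"
      using set_row_insert[of p a] by auto
    then show ?thesis
      using bump_le[OF Cons.prems(1) v] \<open>a < c\<close> by blast
  qed
  moreover have "sorted (bump p a)"
    by (simp add: bump_def)
  ultimately show ?case
    using Cons by (simp add: sorted_append sorted_row_insert)
qed simp

section \<open>The columns from which letters are bumped\<close>

lemma leftmost_bump:
  assumes "v \<in> set (bump p a)"
  shows "leftmost p v = bump_pos p a" "\<not> (\<forall>x \<in> set p. x \<le> a)" "v = p ! bump_pos p a"
proof -
  show nall: "\<not> (\<forall>x \<in> set p. x \<le> a)" and v: "v = p ! bump_pos p a"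
    using assms by (auto simp: bump_def split: if_splits)
  show "leftmost p v = bump_pos p a"
    unfolding leftmost_def
  proof (rule Min_eqI)
    show "bump_pos p a \<le> k" if "k \<in> {k. k < length p \<and> p ! k = v}" for k
      using that bump_pos(2)[OF nall] bump_pos(3)[OF nall, of k] v by (cases "k < bump_pos p a") auto
  qed (use v bump_pos(1)[OF nall] in auto)
qed

lemma leftmost_row_insert:
  assumes "v \<noteq> a" "v \<notin> set (bump p a)"
  shows "leftmost (row_insert p a) v = leftmost p v"
proof -
  have "{k. k < length (row_insert p a) \<and> row_insert p a ! k = v} = {k. k < length p \<and> p ! k = v}"
  proof (cases "\<forall>x \<in> set p. x \<le> a")
    case True
    then show ?thesis
      using assms(1) by (auto simp: row_insert_ge nth_append less_Suc_eq)
  next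
    case False
    then have "row_insert p a = p[bump_pos p a := a]" "v \<noteq> p ! bump_pos p a"
      using assms(2) by (simp_all only: row_insert_def bump_def if_False) auto
    then show ?thesis
      using assms(1) bump_pos(1)[OF False] by (auto simp: nth_list_update split: if_splits)
  qed
  then show ?thesis
    by (simp add: leftmost_def)
qed

lemma leftmost_in:
  assumes "v \<in> set p"
  shows "leftmost p v < length p" "p ! leftmost p v = v"
proof -
  have "leftmost p v \<in> {k. k < length p \<and> p ! k = v}"
    unfolding leftmost_def using assms by (intro Min_in) (auto simp: in_set_conv_nth)
  then show "leftmost p v < length p" "p ! leftmost p v = v"
    by auto
qed

lemma strict_mono_on_leftmost:
  assumes "sorted p"
  shows "strict_mono_on (set p) (leftmost p)"
proof (rule strict_mono_onI)
  fix v v' assume "v \<in> set p" "v' \<in> set p" "v < v'"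
  then show "leftmost p v < leftmost p v'"
    using leftmost_in sorted_nth_mono[OF assms, of "leftmost p v'" "leftmost p v"]
    by (metis leD leI)
qed

text \<open>The first copy of \<open>v\<close> to be bumped is its leftmost one; a smaller letter
  takes its box, and entries only decrease afterwards. As the copies of \<open>v\<close> in the row
  below are meant to reach exactly this column, strictness of columns will follow.\<close>

lemma leftmost_bumped_less:
  "sorted x \<Longrightarrow> v \<in> set (bump_word p x) \<Longrightarrow> row_insert_word p x ! leftmost p v < v"
proof (induction x arbitrary: p)
  case (Cons a x)
  show ?case
  proof (cases "v \<in> set (bump p a)")
    case True
    note l = leftmost_bump[OF True]
    have "row_insert p a = p[bump_pos p a := a]"
      using l(2) by (simp only: row_insert_def if_False)
    then have "leftmost p v < length (row_insert p a)" "row_insert p a ! leftmost p v = a" "a < v"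
      using bump_pos(1,2)[OF l(2)] l(1,3) by simp_all
    then show ?thesis
      using row_insert_word_nth_le[of "leftmost p v" "row_insert p a" x] by simp
  next
    case False
    then have v: "v \<in> set (bump_word (row_insert p a) x)"
      using Cons.prems(2) by simp
    then have "v \<noteq> a"
      using bump_word_gt[OF v] Cons.prems(1) by auto
    then show ?thesis
      using Cons.IH[OF _ v] Cons.prems(1) leftmost_row_insert[OF _ False] by simp
  qed
qed simp

section \<open>The history of one row\<close>

definition blocks :: "(nat \<Rightarrow> nat list) \<Rightarrow> nat \<Rightarrow> nat \<Rightarrow> nat list" where
  "blocks f i j = concat (map f [i..<j])"

lemma blocks_same [simp]: "blocks f i i = []"
  by (simp add: blocks_def)

lemma blocks_split: "i \<le> t \<Longrightarrow> t \<le> j \<Longrightarrow> blocks f i j = blocks f i t @ blocks f t j"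
  unfolding blocks_def by (metis concat_append le_Suc_ex map_append upt_add_eq_append)

lemma blocks_Suc: "i \<le> j \<Longrightarrow> blocks f i (Suc j) = blocks f i j @ f j"
  by (simp add: blocks_def)

lemma set_blocks: "set (blocks f i j) = (\<Union>t \<in> {i..<j}. set (f t))"
  by (simp add: blocks_def)

lemma lds_blocks_cong:
  assumes "\<And>t. i \<le> t \<Longrightarrow> t < j \<Longrightarrow> sorted (f t) \<and> sorted (g t) \<and> set (f t) = set (g t)"
  shows "lds (blocks f i j) = lds (blocks g i j)"
  unfolding blocks_def using assms
  by (intro lds_concat_cong) (auto simp: list_all2_conv_all_nth)

text \<open>The first letter that would be appended to \<open>p\<close> bumps \<open>M\<close>
  instead. The remaining letters of the block are at least as large as the whole row and only
  append, so \<open>M\<close> is the last letter bumped in its block and the two rows agree from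
  then on.\<close>

lemma sentinel_block:
  assumes "\<forall>b \<in> set p \<union> set x. b < M" "sorted x"
  shows "bump_word (p @ [M]) x =
      bump_word p x @ (if length (row_insert_word p x) = length p then [] else [M]) \<and>
    row_insert_word (p @ [M]) x =
      row_insert_word p x @ (if length (row_insert_word p x) = length p then [M] else [])"
  using assms
proof (induction x arbitrary: p)
  case (Cons a x)
  have "a < M"
    using Cons.prems by simp
  have app: "bump (p @ [M]) a = (if \<forall>b \<in> set p. b \<le> a then [M] else bump p a)"
    "row_insert (p @ [M]) a = (if \<forall>b \<in> set p. b \<le> a then row_insert p a else row_insert p a @ [M])"
    using \<open>a < M\<close> by (induction p) auto
  have len: "length (row_insert p a) = (if \<forall>b \<in> set p. b \<le> a then Suc (length p) else length p)"
    by (simp add: row_insert_def)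
  have M: "\<forall>b \<in> set (row_insert p a) \<union> set x. b < M"
    using Cons.prems set_row_insert[of p a] by auto
  show ?case
  proof (cases "\<forall>b \<in> set p. b \<le> a")
    case True
    then have "\<forall>b \<in> set (row_insert p a). \<forall>c \<in> set x. b \<le> c"
      using Cons.prems(2) by (fastforce simp: row_insert_ge)
    then have "bump_word (row_insert p a) x = []" "bump p a = []"
      using Cons.prems(2) True by (auto simp: bump_ge intro!: bump_word_ge)
    moreover have "length (row_insert_word (row_insert p a) x) \<noteq> length p"
      using True len length_row_insert_word[of "row_insert p a" x] by auto
    ultimately show ?thesis
      using app True by simp
  next
    case False
    then have l: "length (row_insert p a) = length p"
      by (simp only: len if_False)
    have "sorted x"
      using Cons.prems(2) by simp
    note IH = Cons.IH[OF M this, unfolded l]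
    show ?thesis
      unfolding bump_word.simps row_insert_word_Cons app if_not_P[OF False] append_assoc
      using IH by (simp only: simp_thms)
  qed
qed simp

text \<open>Here \<open>row t\<close> is a row before step \<open>t\<close>, \<open>f t\<close> the
  word inserted into it and \<open>g t\<close> the word inserted into the row below. Only the
  letters of \<open>g t\<close> are tied to what is bumped, since its multiplicities are dictated by
  columns.\<close>

context
  fixes row :: "nat \<Rightarrow> row" and f g :: "nat \<Rightarrow> nat list" and i j :: nat
  assumes ij: "i \<le> j"
    and sorted_row: "\<And>t. i \<le> t \<Longrightarrow> t \<le> j \<Longrightarrow> sorted (row t)"
    and row_step: "\<And>t. i \<le> t \<Longrightarrow> t < j \<Longrightarrow> row (Suc t) = row_insert_word (row t) (f t)"
    and sorted_f: "\<And>t. i \<le> t \<Longrightarrow> t < j \<Longrightarrow> sorted (f t)"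
    and sorted_g: "\<And>t. i \<le> t \<Longrightarrow> t < j \<Longrightarrow> sorted (g t)"
    and set_g: "\<And>t. i \<le> t \<Longrightarrow> t < j \<Longrightarrow> set (g t) = bumped_word (row t) (f t)"
begin

private abbreviation "bumps \<equiv> \<lambda>t. bump_word (row t) (f t)"

private lemma run:
  assumes "i \<le> s" "s \<le> t" "t \<le> j"
  shows "row_insert_word (row s) (blocks f s t) = row t"
    and "bump_word (row s) (blocks f s t) = blocks bumps s t"
  using assms(2,3,1)
  by (induction t rule: dec_induct)
    (auto simp: blocks_Suc row_insert_word_append bump_word_append row_step)

private lemma sentinel_run:
  assumes M: "\<forall>b \<in> set (row i) \<union> set (blocks f i j). b < M"
    and "i \<le> t" "t \<le> j" "\<And>s. i \<le> s \<Longrightarrow> s < t \<Longrightarrow> length (row (Suc s)) = length (row s)"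
  shows "row_insert_word (row i @ [M]) (blocks f i t) = row t @ [M] \<and>
    bump_word (row i @ [M]) (blocks f i t) = blocks bumps i t"
  using assms(2-)
proof (induction t rule: dec_induct)
  case (step t)
  have "set (row t) \<subseteq> set (row i) \<union> set (blocks f i j)"
    using run(1)[of i t] set_row_insert_word[of "row i" "blocks f i t"] step
    by (fastforce simp: set_blocks)
  moreover have "set (f t) \<subseteq> set (blocks f i j)"
    using step by (auto simp: set_blocks intro!: bexI[of _ t])
  ultimately have "\<forall>b \<in> set (row t) \<union> set (f t). b < M"
    using M by blast
  then have "bump_word (row t @ [M]) (f t) = bumps t \<and>
      row_insert_word (row t @ [M]) (f t) = row_insert_word (row t) (f t) @ [M]"
    using sentinel_block[of "row t" "f t" M] step.prems(2)[of t] step sorted_f row_step[of t]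
    by simp
  then show ?case
    using step row_step[of t] by (simp add: blocks_Suc row_insert_word_append bump_word_append)
qed simp

private lemma obtain_sentinel:
  obtains M where "\<forall>b \<in> set (row i) \<union> set (blocks f i j). b < M"
  using finite_nat_set_iff_bounded[of "set (row i) \<union> set (blocks f i j)"] by auto

private lemma lds_bumps:
  "i \<le> s \<Longrightarrow> t \<le> j \<Longrightarrow> lds (blocks bumps s t) = lds (blocks g s t)"
  by (intro lds_blocks_cong)
    (auto simp: sorted_bump_word sorted_row sorted_f sorted_g set_g set_bump_word)

lemma lds_row_no_growth:
  assumes "\<And>t. i \<le> t \<Longrightarrow> t < j \<Longrightarrow> length (row (Suc t)) = length (row t)"
  shows "lds (blocks f i j) = lds (blocks g i j)"
proof -
  obtain M where M: "\<forall>b \<in> set (row i) \<union> set (blocks f i j). b < M"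
    by (rule obtain_sentinel)
  have "lds (blocks f i j) = lds (bump_word (row i @ [M]) (blocks f i j))"
    using M sorted_row ij by (simp add: lds_bump_word_sentinel)
  also have "\<dots> = lds (blocks g i j)"
    using sentinel_run[OF M ij order_refl assms] lds_bumps by simp
  finally show ?thesis .
qed

text \<open>At the first growth the sentinel is bumped, so it separates the letters bumped up to that
  time from the later ones.\<close>

lemma lds_row_growth:
  assumes "i \<le> t" "t < j" "length (row (Suc t)) \<noteq> length (row t)"
    and "\<And>s. i \<le> s \<Longrightarrow> s < t \<Longrightarrow> length (row (Suc s)) = length (row s)"
  shows "lds (blocks f i j) = max (lds (blocks g i j)) (Suc (lds (blocks g (Suc t) j)))"
proof -
  obtain M where M: "\<forall>b \<in> set (row i) \<union> set (blocks f i j). b < M"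
    by (rule obtain_sentinel)
  have sub: "set (row t) \<subseteq> set (row i) \<union> set (blocks f i j)"
    using run(1)[of i t] set_row_insert_word[of "row i" "blocks f i t"] assms
    by (fastforce simp: set_blocks)
  moreover have "set (f t) \<subseteq> set (blocks f i j)"
    using assms by (auto simp: set_blocks)
  ultimately have "\<forall>b \<in> set (row t) \<union> set (f t). b < M"
    using M by blast
  then have *: "bump_word (row t @ [M]) (f t) = bumps t @ [M] \<and>
      row_insert_word (row t @ [M]) (f t) = row (Suc t)"
    using assms sorted_f row_step[of t] sentinel_block[of "row t" "f t" M] by auto
  have split: "blocks h i j = blocks h i t @ h t @ blocks h (Suc t) j" for h :: "nat \<Rightarrow> nat list"
    using assms blocks_split[of i "Suc t" j h] by (simp add: blocks_Suc)
  have "set (blocks bumps i j) \<subseteq> set (row i) \<union> set (blocks f i j)"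
    using set_bump_word_subset[of "row i" "blocks f i j"] run(2)[of i j] ij by simp
  then have less: "\<forall>b \<in> set (blocks bumps i j). b < M"
    using M by blast
  have "lds (blocks f i j) = lds (bump_word (row i @ [M]) (blocks f i j))"
    using M sorted_row ij by (simp add: lds_bump_word_sentinel)
  also have "\<dots> = lds ((blocks bumps i t @ bumps t) @ M # blocks bumps (Suc t) j)"
    using sentinel_run[OF M, of t] * run(2)[of "Suc t" j] assms
    by (simp add: split[of f] bump_word_append)
  also have "\<dots> = max (lds (blocks bumps i j)) (Suc (lds (blocks bumps (Suc t) j)))"
    using less by (subst lds_insert_max) (auto simp: split[of bumps])
  also have "\<dots> = max (lds (blocks g i j)) (Suc (lds (blocks g (Suc t) j)))"
    using lds_bumps assms by simp
  finally show ?thesis .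
qed

end

section \<open>The inserted words\<close>

text \<open>In a sorted row this is the first column past the entries at most \<open>a\<close>.
  Unlike \<open>rightmost\<close> it is defined whether or not \<open>a\<close> occurs, and each
  inserted copy of \<open>a\<close> raises it by one.\<close>

abbreviation count_le :: "nat \<Rightarrow> row \<Rightarrow> nat" where
  "count_le a p \<equiv> length (filter (\<lambda>b. b \<le> a) p)"

lemma nth_le_iff_count_le:
  "sorted p \<Longrightarrow> k < length p \<and> p ! k \<le> a \<longleftrightarrow> k < count_le a p"
proof (induction p arbitrary: k)
  case (Cons b p)
  have "filter (\<lambda>b. b \<le> a) p = []" if "\<not> b \<le> a"
    using that Cons.prems by (auto simp: filter_empty_conv)
  moreover have "\<not> p ! k \<le> a" if "\<not> b \<le> a" "k < length p" for k
    using that(1) Cons.prems nth_mem[OF that(2)] by fastforce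
  ultimately show ?case
    using Cons by (cases k) auto
qed simp

lemma Suc_rightmost:
  assumes "sorted p" "a \<in> set p"
  shows "Suc (rightmost p a) = count_le a p"
proof -
  let ?c = "count_le a p"
  obtain k where k: "k < length p" "p ! k = a"
    using assms(2) by (auto simp: in_set_conv_nth)
  then have "k < ?c"
    using nth_le_iff_count_le[OF assms(1), of k a] by simp
  then have c: "?c - 1 < length p" "p ! (?c - 1) \<le> a"
    using nth_le_iff_count_le[OF assms(1), of "?c - 1" a] by auto
  have "p ! k \<le> p ! (?c - 1)"
    using \<open>k < ?c\<close> c(1) by (intro sorted_nth_mono[OF assms(1)]) auto
  then have "p ! (?c - 1) = a"
    using c(2) k(2) by simp
  moreover have "i \<le> ?c - 1" if "i < length p" "p ! i = a" for i
    using that nth_le_iff_count_le[OF assms(1), of i a] by simp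
  ultimately have "rightmost p a = ?c - 1"
    unfolding rightmost_def using c(1) by (intro Max_eqI) auto
  then show ?thesis
    using \<open>k < ?c\<close> by simp
qed

lemma filter_le_row_insert_word:
  "\<forall>b \<in> set x. a < b \<Longrightarrow>
     filter (\<lambda>b. b \<le> a) (row_insert_word p x) = filter (\<lambda>b. b \<le> a) p"
proof (induction x arbitrary: p)
  case (Cons b x)
  then have "a < b"
    by simp
  then have "filter (\<lambda>b. b \<le> a) (row_insert p b) = filter (\<lambda>b. b \<le> a) p"
    by (induction p) auto
  then show ?case
    using Cons by simp
qed simp

lemma count_le_row_insert_same: "sorted p \<Longrightarrow> count_le a (row_insert p a) = Suc (count_le a p)"
proof (induction p)
  case (Cons b p)
  have "filter (\<lambda>b. b \<le> a) p = []" if "\<not> b \<le> a"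
    using that Cons.prems by (auto simp: filter_empty_conv)
  then show ?case
    using Cons by auto
qed simp

text \<open>The new \<open>a\<close> sits in column \<open>count_le a p\<close>. If it replaces an
  entry at most \<open>c\<close>, the count is unchanged; otherwise nothing further right is at most
  \<open>c\<close>, and the count is the second argument of \<open>max\<close>.\<close>

lemma count_le_row_insert:
  "sorted p \<Longrightarrow> a \<le> c \<Longrightarrow> count_le c (row_insert p a) \<le> max (count_le c p) (Suc (count_le a p))"
proof (induction p)
  case (Cons b p)
  have "filter (\<lambda>b. b \<le> c) p = []" if "\<not> b \<le> c"
    using that Cons.prems by (auto simp: filter_empty_conv)
  then show ?case
    using Cons by auto
qed simp

lemma count_le_replicate_same:
  "sorted p \<Longrightarrow> count_le a (row_insert_word p (replicate m a)) = count_le a p + m"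
  by (induction m arbitrary: p) (auto simp: sorted_row_insert count_le_row_insert_same)

lemma count_le_replicate:
  "sorted p \<Longrightarrow> a \<le> c \<Longrightarrow>
     count_le c (row_insert_word p (replicate m a)) \<le> max (count_le c p) (count_le a p + m)"
proof (induction m arbitrary: p)
  case (Suc m)
  then have "count_le c (row_insert_word p (replicate (Suc m) a)) \<le>
      max (count_le c (row_insert p a)) (Suc (count_le a p) + m)"
    by (metis count_le_row_insert_same replicate_Suc row_insert_word_Cons sorted_row_insert)
  then show ?case
    using count_le_row_insert[OF Suc.prems] by (auto simp: le_max_iff_disj)
qed simp

abbreviation mult_list :: "nat list \<Rightarrow> (nat \<Rightarrow> nat) \<Rightarrow> nat list" where
  "mult_list as m \<equiv> concat (map (\<lambda>a. replicate (m a) a) as)"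

text \<open>Larger letters inserted later leave the entries at most \<open>a\<close> alone, so the
  column of \<open>a\<close> is settled once its copies are in. Solving for \<open>m a\<close>
  yields both existence and uniqueness of the multiplicities.\<close>

lemma rightmost_mult_list_Cons:
  assumes "sorted p" "sorted_wrt (<) (a # as)" "1 \<le> m a"
  shows "Suc (rightmost (row_insert_word p (mult_list (a # as) m)) a) = count_le a p + m a"
proof -
  let ?p1 = "row_insert_word p (replicate (m a) a)"
  let ?q = "row_insert_word p (mult_list (a # as) m)"
  have q: "?q = row_insert_word ?p1 (mult_list as m)"
    by (simp add: row_insert_word_append)
  have f: "filter (\<lambda>b. b \<le> a) ?q = filter (\<lambda>b. b \<le> a) ?p1"
    unfolding q using assms(2) by (intro filter_le_row_insert_word) auto
  have "a \<in> set ?p1"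
  proof -
    obtain k where k: "m a = Suc k"
      using assms(3) by (cases "m a") auto
    have "a \<in> set (row_insert r a)" for r
      by (induction r) auto
    moreover have "replicate (m a) a = replicate k a @ [a]"
      by (simp add: k replicate_append_same)
    then have "?p1 = row_insert (row_insert_word p (replicate k a)) a"
      by (simp only: row_insert_word_append row_insert_word_Cons row_insert_word_Nil)
    ultimately show ?thesis
      by simp
  qed
  then have "a \<in> set ?q"
    using f by (metis (mono_tags, lifting) mem_Collect_eq order_refl set_filter)
  then have "Suc (rightmost ?q a) = count_le a ?q"
    using assms(1) by (intro Suc_rightmost sorted_row_insert_word)
  then show ?thesis
    using f count_le_replicate_same[OF assms(1)] by simp
qed

lemma mult_list_exists:
  assumes "sorted p" "sorted_wrt (<) as" "strict_mono_on (set as) col"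
    and "\<forall>a \<in> set as. count_le a p \<le> col a"
  shows "\<exists>m. \<forall>a \<in> set as. 1 \<le> m a \<and> rightmost (row_insert_word p (mult_list as m)) a = col a"
  using assms
proof (induction as arbitrary: p)
  case (Cons a as)
  \<comment> \<open>The solution of \<open>rightmost_mult_list_Cons\<close> for the column
    \<open>col a\<close>; it is positive because the entries at most \<open>a\<close> end before
    that column.\<close>
  define n where "n = Suc (col a) - count_le a p"
  define p1 where "p1 = row_insert_word p (replicate n a)"
  have n: "1 \<le> n" "count_le a p + n = Suc (col a)"
    using Cons.prems(4) by (auto simp: n_def)
  have "sorted p1"
    using Cons.prems(1) by (simp add: p1_def sorted_row_insert_word)
  \<comment> \<open>The copies of \<open>a\<close> end in column \<open>col a\<close>, so they raise
    the count for \<open>b\<close> to at most \<open>Suc (col a)\<close>, and \<open>col b\<close>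
    is no smaller.\<close>
  moreover have "count_le b p1 \<le> col b" if "b \<in> set as" for b
  proof -
    have "a < b" "col a < col b"
      using that Cons.prems(2) strict_mono_onD[OF Cons.prems(3), of a b] by auto
    then show ?thesis
      using count_le_replicate[OF Cons.prems(1), of a b n] n(2) Cons.prems(4) that
      by (fastforce simp: p1_def)
  qed
  moreover have "strict_mono_on (set as) col"
    using Cons.prems(3) by (rule monotone_on_subset) auto
  ultimately obtain m where
    m: "\<forall>b \<in> set as. 1 \<le> m b \<and> rightmost (row_insert_word p1 (mult_list as m)) b = col b"
    using Cons.IH[of p1] Cons.prems(2) by auto
  have "a \<notin> set as"
    using Cons.prems(2) by auto
  then have ml: "mult_list as (m(a := n)) = mult_list as m"
    by (auto intro!: arg_cong[where f = concat] map_cong)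
  have "rightmost (row_insert_word p (mult_list (a # as) (m(a := n)))) b = col b"
    if "b \<in> set (a # as)" for b
  proof (cases "b = a")
    case True
    then show ?thesis
      using rightmost_mult_list_Cons[OF Cons.prems(1,2), of "m(a := n)"] n by simp
  next
    case False
    then show ?thesis
      using that m ml by (simp add: row_insert_word_append p1_def)
  qed
  then show ?case
    using m n(1) by (intro exI[of _ "m(a := n)"]) auto
qed simp

lemma mult_list_unique:
  assumes "sorted p" "sorted_wrt (<) as"
    and "\<forall>a \<in> set as. 1 \<le> m a \<and> 1 \<le> m' a \<and>
      rightmost (row_insert_word p (mult_list as m)) a =
      rightmost (row_insert_word p (mult_list as m')) a"
  shows "mult_list as m = mult_list as m'"
  using assms
proof (induction as arbitrary: p)
  case (Cons a as)
  have "count_le a p + m a = count_le a p + m' a"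
    using rightmost_mult_list_Cons[OF Cons.prems(1,2), of m]
      rightmost_mult_list_Cons[OF Cons.prems(1,2), of m'] Cons.prems(3) by simp
  then have a: "m a = m' a"
    by simp
  have "mult_list as m = mult_list as m'"
    using Cons.prems a
    by (intro Cons.IH[of "row_insert_word p (replicate (m a) a)"])
      (auto simp: sorted_row_insert_word row_insert_word_append)
  then show ?case
    using a by simp
qed simp

text \<open>The last assumption says that the entries at most \<open>a\<close> end before column
  \<open>col a\<close>, leaving room for a copy of \<open>a\<close>. In the first row that column
  lies past the end; in a later row the assumption comes from strictness of columns.\<close>

lemma alpha_plus:
  assumes "sorted p" "finite S" "strict_mono_on S col"
    and "\<And>a. a \<in> S \<Longrightarrow> col a < length p \<Longrightarrow> a < p ! col a"
  shows "set (alpha_plus col S p) = S" "sorted (alpha_plus col S p)"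
    and "\<And>a. a \<in> S \<Longrightarrow> rightmost (row_insert_word p (alpha_plus col S p)) a = col a"
proof -
  let ?as = "sorted_list_of_set S"
  let ?P = "\<lambda>\<alpha>. \<exists>m. (\<forall>a \<in> S. 1 \<le> m a) \<and> \<alpha> = mult_word S m \<and>
     (\<forall>a \<in> S. rightmost (row_insert_word p \<alpha>) a = col a)"
  have as: "sorted_wrt (<) ?as" "set ?as = S"
    using assms(2) by auto
  have "count_le a p \<le> col a" if "a \<in> S" for a
    using assms(4)[OF that] nth_le_iff_count_le[OF assms(1), of "col a" a] by (meson leD leI)
  then have "\<exists>\<alpha>. ?P \<alpha>"
    using mult_list_exists[OF assms(1) as(1), of col] assms(3)
    unfolding as(2) mult_word_def by blast
  moreover have "\<alpha> = \<beta>" if "?P \<alpha>" "?P \<beta>" for \<alpha> \<beta>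
    using that mult_list_unique[OF assms(1) as(1)] unfolding as(2) mult_word_def by auto
  ultimately have "?P (alpha_plus col S p)"
    unfolding alpha_plus_def by (rule theI'[OF ex_ex1I])
  then obtain m where m: "\<forall>a \<in> S. 1 \<le> m a" "alpha_plus col S p = mult_list ?as m"
    and r: "\<forall>a \<in> S. rightmost (row_insert_word p (alpha_plus col S p)) a = col a"
    unfolding mult_word_def by blast
  have "sorted (mult_list xs m)" if "sorted_wrt (<) xs" for xs
    using that by (induction xs) (fastforce simp: sorted_append less_imp_le)+
  then show "sorted (alpha_plus col S p)"
    using as(1) m(2) by simp
  have "m a \<noteq> 0" if "a \<in> S" for a
    using m(1) that by fastforce
  then show "set (alpha_plus col S p) = S"
    using as(2) m(2) by auto
  show "rightmost (row_insert_word p (alpha_plus col S p)) a = col a" if "a \<in> S" for a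
    using r that by blast
qed

section \<open>Tableaux\<close>

text \<open>With empty rows past the end, creating a new row is growth of an empty one, and all rows
  obey the same recursion.\<close>

definition row_of :: "tableau \<Rightarrow> nat \<Rightarrow> row" where
  "row_of P r = (if r < length P then P ! r else [])"

lemma row_of_simps [simp]:
  "row_of [] r = []" "row_of (p # P) 0 = p" "row_of (p # P) (Suc r) = row_of P r"
  by (auto simp: row_of_def)

text \<open>Semistandardness; the bound on \<open>c\<close> also forces the row lengths to decrease
  weakly.\<close>

definition tableau_ok :: "tableau \<Rightarrow> bool" where
  "tableau_ok P \<longleftrightarrow> (\<forall>r. sorted (row_of P r)) \<and>
     (\<forall>r c. c < length (row_of P (Suc r)) \<longrightarrow>
        c < length (row_of P r) \<and> row_of P r ! c < row_of P (Suc r) ! c)"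

lemma tableau_ok_sorted: "tableau_ok P \<Longrightarrow> sorted (row_of P r)"
  by (simp add: tableau_ok_def)

lemma tableau_ok_strict:
  "tableau_ok P \<Longrightarrow> c < length (row_of P (Suc r)) \<Longrightarrow>
     c < length (row_of P r) \<and> row_of P r ! c < row_of P (Suc r) ! c"
  by (simp add: tableau_ok_def)

lemma tableau_ok_Cons:
  assumes "tableau_ok (p # P)"
  shows "tableau_ok P"
  unfolding tableau_ok_def
  using tableau_ok_sorted[OF assms, of "Suc r" for r] tableau_ok_strict[OF assms, of _ "Suc r" for r]
  by simp

text \<open>\<open>A r\<close> is the word inserted into row \<open>r\<close>, empty once nothing has been bumped.\<close>

lemma insert_rows_words:
  assumes "tableau_ok P" "finite S" "strict_mono_on S col"
    and "\<And>a. a \<in> S \<Longrightarrow> col a < length (row_of P 0) \<Longrightarrow> a < row_of P 0 ! col a"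
  shows "\<exists>A. set (A 0) = S \<and> (\<forall>r. sorted (A r)) \<and>
    (\<forall>r. row_of (insert_rows col S P) r = row_insert_word (row_of P r) (A r)) \<and>
    (\<forall>r. set (A (Suc r)) = bumped_word (row_of P r) (A r)) \<and>
    (\<forall>a \<in> S. rightmost (row_of (insert_rows col S P) 0) a = col a) \<and>
    (\<forall>r. \<forall>a \<in> set (A (Suc r)). rightmost (row_of (insert_rows col S P) (Suc r)) a =
       leftmost (row_of P r) a)"
  using assms
proof (induction P arbitrary: S col)
  case Nil
  show ?case
  proof (cases "S = {}")
    case True
    then show ?thesis
      by (intro exI[of _ "\<lambda>_. []"]) simp
  next
    case False
    note \<alpha> = alpha_plus[of "[]" S col, OF _ Nil(2,3)]
    have "bumped_word [] (alpha_plus col S []) = {}"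
      using bump_word_ge[of "alpha_plus col S []" "[]"] \<alpha>(2)
      by (simp add: set_bump_word[symmetric])
    then show ?thesis
      using \<alpha> False
      by (intro exI[of _ "\<lambda>r. if r = 0 then alpha_plus col S [] else []"]) (auto simp: row_of_def)
  qed
next
  case (Cons p P)
  show ?case
  proof (cases "S = {}")
    case True
    then show ?thesis
      by (intro exI[of _ "\<lambda>_. []"]) simp
  next
    case False
    have "sorted p"
      using tableau_ok_sorted[OF Cons.prems(1), of 0] by simp
    have "a < p ! col a" if "a \<in> S" "col a < length p" for a
      using Cons.prems(4) that by simp
    note \<alpha> = alpha_plus[OF \<open>sorted p\<close> Cons.prems(2,3) this]
    let ?\<alpha> = "alpha_plus col S p"
    let ?B = "bumped_word p ?\<alpha>"
    let ?R = "insert_rows (leftmost p) ?B P"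
    have B: "v \<in> set p" if "v \<in> ?B" for v
      using that bump_word_subset[OF \<alpha>(2)] unfolding set_bump_word[symmetric] by blast
    have "finite ?B"
      unfolding set_bump_word[symmetric] by simp
    moreover have "strict_mono_on ?B (leftmost p)"
      using strict_mono_on_leftmost[OF \<open>sorted p\<close>] by (rule monotone_on_subset) (use B in blast)
    \<comment> \<open>Under the leftmost \<open>a\<close> of \<open>p\<close> the next row has a
      larger entry or has ended.\<close>
    moreover have "a < row_of P 0 ! leftmost p a"
      if "a \<in> ?B" "leftmost p a < length (row_of P 0)" for a
      using that leftmost_in(2)[OF B] tableau_ok_strict[OF Cons.prems(1), of "leftmost p a" 0] by simp
    ultimately obtain A where A: "set (A 0) = ?B" "\<forall>r. sorted (A r)"
      "\<forall>r. row_of ?R r = row_insert_word (row_of P r) (A r)"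
      "\<forall>r. set (A (Suc r)) = bumped_word (row_of P r) (A r)"
      "\<forall>a \<in> ?B. rightmost (row_of ?R 0) a = leftmost p a"
      "\<forall>r. \<forall>a \<in> set (A (Suc r)). rightmost (row_of ?R (Suc r)) a = leftmost (row_of P r) a"
      using Cons.IH[OF tableau_ok_Cons[OF Cons.prems(1)], of ?B "leftmost p"] by blast
    let ?A = "case_nat ?\<alpha> A"
    have R: "insert_rows col S (p # P) = row_insert_word p ?\<alpha> # ?R"
      using False by simp
    have "sorted (?A r)"
      "row_of (insert_rows col S (p # P)) r = row_insert_word (row_of (p # P) r) (?A r)"
      "set (?A (Suc r)) = bumped_word (row_of (p # P) r) (?A r)"
      "\<forall>a \<in> set (?A (Suc r)). rightmost (row_of (insert_rows col S (p # P)) (Suc r)) a =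
         leftmost (row_of (p # P) r) a" for r
      unfolding R using A \<alpha>(2) by (cases r; simp)+
    moreover have "set (?A 0) = S"
      "\<forall>a \<in> S. rightmost (row_of (insert_rows col S (p # P)) 0) a = col a"
      unfolding R using \<alpha>(1,3) by simp_all
    ultimately show ?thesis
      by (intro exI[of _ ?A] conjI allI)
  qed
qed

text \<open>An entry \<open>b\<close> of row \<open>Suc r\<close> is new or old. If new, it was
  bumped from row \<open>r\<close> and lies weakly left of its old leftmost column there, where row
  \<open>r\<close> now has an entry below \<open>b\<close>. If old, the entry above it can only have
  decreased.\<close>

lemma tableau_ok_irsk_insert:
  assumes "tableau_ok P"
  shows "tableau_ok (irsk_insert P a)"
    and "\<exists>A. set (A 0) = {a} \<and> (\<forall>r. sorted (A r)) \<and>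
      (\<forall>r. row_of (irsk_insert P a) r = row_insert_word (row_of P r) (A r)) \<and>
      (\<forall>r. set (A (Suc r)) = bumped_word (row_of P r) (A r))"
proof -
  let ?P' = "irsk_insert P a"
  have "(case P of [] \<Rightarrow> 0 | p # _ \<Rightarrow> length p) = length (row_of P 0)"
    by (simp split: list.split)
  then have "?P' = insert_rows (\<lambda>_. length (row_of P 0)) {a} P"
    by (simp add: irsk_insert_def)
  then obtain A where A: "set (A 0) = {a}" "\<And>r. sorted (A r)"
    "\<And>r. row_of ?P' r = row_insert_word (row_of P r) (A r)"
    "\<And>r. set (A (Suc r)) = bumped_word (row_of P r) (A r)"
    "\<And>r b. b \<in> set (A (Suc r)) \<Longrightarrow> rightmost (row_of ?P' (Suc r)) b = leftmost (row_of P r) b"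
    \<comment> \<open>A constant column function is strictly monotone on a singleton, and the column
      just past the first row makes the entry condition vacuous.\<close>
    using insert_rows_words[OF assms, of "{a}" "\<lambda>_. length (row_of P 0)"]
    by (auto simp: strict_mono_on_def)
  then show "\<exists>A. set (A 0) = {a} \<and> (\<forall>r. sorted (A r)) \<and>
      (\<forall>r. row_of ?P' r = row_insert_word (row_of P r) (A r)) \<and>
      (\<forall>r. set (A (Suc r)) = bumped_word (row_of P r) (A r))"
    by blast
  have sorted: "sorted (row_of P r)" for r
    by (rule tableau_ok_sorted[OF assms])
  then have sorted': "sorted (row_of ?P' r)" for r
    by (simp add: A(3) sorted_row_insert_word)
  have "c < length (row_of ?P' r) \<and> row_of ?P' r ! c < row_of ?P' (Suc r) ! c"
    if c: "c < length (row_of ?P' (Suc r))" for r c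
  proof -
    define b where "b = row_of ?P' (Suc r) ! c"
    have len: "length (row_of P r) \<le> length (row_of ?P' r)"
      by (simp add: A(3) length_row_insert_word)
    consider "b \<in> set (A (Suc r))" | "c < length (row_of P (Suc r))" "b = row_of P (Suc r) ! c"
      using row_insert_word_nth_cases[of c "row_of P (Suc r)" "A (Suc r)"] c
      unfolding b_def A(3) by blast
    then show ?thesis
    proof cases
      case 1
      then have v: "b \<in> set (bump_word (row_of P r) (A r))"
        by (simp add: A(4) set_bump_word)
      let ?l = "leftmost (row_of P r) b"
      have l: "?l < length (row_of P r)"
        using leftmost_in(1) bump_word_subset[OF A(2) v] by blast
      have "c \<le> ?l"
        using c b_def unfolding A(5)[OF 1, symmetric] rightmost_def by (intro Max_ge) auto
      then have "row_of ?P' r ! c \<le> row_of ?P' r ! ?l"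
        using l len by (intro sorted_nth_mono[OF sorted']) auto
      also have "\<dots> < b"
        unfolding A(3) by (rule leftmost_bumped_less[OF A(2) v])
      finally show ?thesis
        using \<open>c \<le> ?l\<close> l len b_def by simp
    next
      case 2
      then have "c < length (row_of P r)" "row_of P r ! c < b"
        using tableau_ok_strict[OF assms, of c r] by auto
      then show ?thesis
        using len row_insert_word_nth_le[of c "row_of P r" "A r"] b_def by (simp add: A(3))
    qed
  qed
  then show "tableau_ok ?P'"
    using sorted' by (simp add: tableau_ok_def)
qed

section \<open>The rows as functions of time\<close>

lemma P_tableau_Suc: "t < length w \<Longrightarrow> P_tableau (take (Suc t) w) = irsk_insert (P_tableau (take t w)) (w ! t)"
  by (simp add: P_tableau_def take_Suc_conv_app_nth)

lemma tableau_ok_P_tableau: "tableau_ok (P_tableau w)"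
proof (induction w rule: rev_induct)
  case Nil
  then show ?case
    by (simp add: P_tableau_def tableau_ok_def)
next
  case (snoc a w)
  then show ?case
    using tableau_ok_irsk_insert(1) by (simp add: P_tableau_def)
qed

definition row_at :: "nat list \<Rightarrow> nat \<Rightarrow> nat \<Rightarrow> row" where
  "row_at w r t = row_of (P_tableau (take t w)) r"

lemma sorted_row_at: "sorted (row_at w r t)"
  using tableau_ok_P_tableau by (simp add: row_at_def tableau_ok_def)

text \<open>\<open>A r t\<close> is the word entering row \<open>r\<close> while
  \<open>w ! t\<close> is processed. Columns are deliberately absent: their effect survives only in
  the rows themselves.\<close>

definition inserted_words :: "nat list \<Rightarrow> (nat \<Rightarrow> nat \<Rightarrow> nat list) \<Rightarrow> bool" where
  "inserted_words w A \<longleftrightarrow> (\<forall>t < length w. set (A 0 t) = {w ! t} \<and> (\<forall>r. sorted (A r t)) \<and>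
     (\<forall>r. row_at w r (Suc t) = row_insert_word (row_at w r t) (A r t)) \<and>
     (\<forall>r. set (A (Suc r) t) = bumped_word (row_at w r t) (A r t)))"

lemma inserted_wordsD:
  assumes "inserted_words w A" "t < length w"
  shows "set (A 0 t) = {w ! t}" "sorted (A r t)"
    "row_at w r (Suc t) = row_insert_word (row_at w r t) (A r t)"
    "set (A (Suc r) t) = bumped_word (row_at w r t) (A r t)"
  using assms unfolding inserted_words_def by blast+

lemma inserted_words_exist: "\<exists>A. inserted_words w A"
proof -
  have "\<exists>A. t < length w \<longrightarrow> set (A 0) = {w ! t} \<and> (\<forall>r. sorted (A r)) \<and>
      (\<forall>r. row_at w r (Suc t) = row_insert_word (row_at w r t) (A r)) \<and>
      (\<forall>r. set (A (Suc r)) = bumped_word (row_at w r t) (A r))" for t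
    using tableau_ok_irsk_insert(2)[of "P_tableau (take t w)" "w ! t", OF tableau_ok_P_tableau]
    by (cases "t < length w") (simp_all add: row_at_def P_tableau_Suc)
  then have "\<forall>t. \<exists>A. t < length w \<longrightarrow> set (A 0) = {w ! t} \<and> (\<forall>r. sorted (A r)) \<and>
      (\<forall>r. row_at w r (Suc t) = row_insert_word (row_at w r t) (A r)) \<and>
      (\<forall>r. set (A (Suc r)) = bumped_word (row_at w r t) (A r))" ..
  from choice[OF this] obtain A where
    "\<forall>t. t < length w \<longrightarrow> set (A t 0) = {w ! t} \<and> (\<forall>r. sorted (A t r)) \<and>
      (\<forall>r. row_at w r (Suc t) = row_insert_word (row_at w r t) (A t r)) \<and>
      (\<forall>r. set (A t (Suc r)) = bumped_word (row_at w r t) (A t r))"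
    by blast
  then have "inserted_words w (\<lambda>r t. A t r)"
    unfolding inserted_words_def by blast
  then show ?thesis
    by (intro exI[of _ "\<lambda>r t. A t r"])
qed

lemma row_at_mono:
  assumes "s \<le> t" "t \<le> length w"
  shows "length (row_at w r s) \<le> length (row_at w r t)"
proof -
  obtain A where A: "inserted_words w A"
    using inserted_words_exist by blast
  have Suc: "length (row_at w r k) \<le> length (row_at w r (Suc k))" if "k < length w" for k
    unfolding inserted_wordsD(3)[OF A that] by (rule length_row_insert_word)
  show ?thesis
    using assms
  proof (induction t rule: dec_induct)
    case (step k)
    then show ?case
      using Suc[of k] by simp
  qed simp
qed

lemma row_at_empty:
  assumes "length (P_tableau w) \<le> r" "t \<le> length w"
  shows "row_at w r t = []"
  using row_at_mono[OF assms(2) order_refl, of r] assms(1) by (simp add: row_at_def row_of_def)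

context
  fixes w :: "nat list" and A :: "nat \<Rightarrow> nat \<Rightarrow> nat list" and r i j :: nat
  assumes A: "inserted_words w A" and ij: "i \<le> j" "j \<le> length w"
begin

private lemma D:
  assumes "t < j"
  shows "sorted (A r t)" "row_at w r (Suc t) = row_insert_word (row_at w r t) (A r t)"
    "set (A (Suc r) t) = bumped_word (row_at w r t) (A r t)" "sorted (A (Suc r) t)"
  using inserted_wordsD(2-4)[OF A, of t] assms ij(2) by simp_all

text \<open>Start of the downward induction: rows never shrink, so a row absent at the end was
  always empty, and only the empty word keeps it so.\<close>

lemma lds_inserted_words_empty:
  assumes "length (P_tableau w) \<le> r"
  shows "lds (blocks (A r) i j) = 0"
proof -
  have "A r t = []" if "t < j" for t
  proof (cases "A r t")
    case (Cons a x)
    have "row_insert_word [] (A r t) = []"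
      using D(2)[OF that] row_at_empty[OF assms] that ij(2) by simp
    then show ?thesis
      using Cons length_row_insert_word[of "[a]" x] by simp
  qed
  then have "blocks (A r) i j = []"
    by (auto simp: blocks_def)
  then show ?thesis
    by simp
qed

lemma lds_inserted_words_no_growth:
  assumes "\<And>t. i \<le> t \<Longrightarrow> t < j \<Longrightarrow> length (row_at w r (Suc t)) = length (row_at w r t)"
  shows "lds (blocks (A r) i j) = lds (blocks (A (Suc r)) i j)"
  by (rule lds_row_no_growth[where row = "row_at w r"])
    (use ij D sorted_row_at assms in blast)+

lemma lds_inserted_words_growth:
  assumes "i \<le> t" "t < j" "length (row_at w r (Suc t)) \<noteq> length (row_at w r t)"
    and "\<And>s. i \<le> s \<Longrightarrow> s < t \<Longrightarrow> length (row_at w r (Suc s)) = length (row_at w r s)"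
  shows "lds (blocks (A r) i j) =
    max (lds (blocks (A (Suc r)) i j)) (Suc (lds (blocks (A (Suc r)) (Suc t) j)))"
  by (rule lds_row_growth[where row = "row_at w r"])
    (use ij D sorted_row_at assms in blast)+

end

section \<open>From recording tableaux to longest decreasing subsequences\<close>

lemma prefix_shape_iff: "(r, c) \<in> prefix_shape w t \<longleftrightarrow> c < length (row_at w r t)"
  by (simp add: prefix_shape_def shape_def row_at_def row_of_def)

lemma prefix_shape_mono:
  assumes "s \<le> t" "t \<le> length w"
  shows "prefix_shape w s \<subseteq> prefix_shape w t"
proof (rule subrelI)
  fix r c assume "(r, c) \<in> prefix_shape w s"
  then show "(r, c) \<in> prefix_shape w t"
    using row_at_mono[OF assms, of r] by (simp add: prefix_shape_iff)
qed

text \<open>Shapes grow with the prefix, so a box enters exactly once, and its label is the time of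
  entry. The recording tableau thus gives back the shape of every prefix.\<close>

lemma prefix_shape_Q_tableau:
  assumes "t \<le> length w"
  shows "b \<in> prefix_shape w t \<longleftrightarrow> (\<exists>k \<le> t. Q_tableau w b = Some k)"
proof (cases "b \<in> prefix_shape w (length w)")
  case True
  define m where "m = (LEAST m. b \<in> prefix_shape w m)"
  have m: "b \<in> prefix_shape w m" "m \<le> length w"
    unfolding m_def
    by (rule LeastI[where P = "\<lambda>m. b \<in> prefix_shape w m", OF True],
        rule Least_le[where P = "\<lambda>m. b \<in> prefix_shape w m", OF True])
  have least: "k < m \<Longrightarrow> b \<notin> prefix_shape w k" for k
    unfolding m_def by (rule not_less_Least)
  have "prefix_shape w 0 = {}"
    by (simp add: prefix_shape_def P_tableau_def shape_def)
  then have "m \<noteq> 0"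
    using m(1) by (cases m) auto
  have "(THE j. 1 \<le> j \<and> j \<le> length w \<and> b \<in> prefix_shape w j - prefix_shape w (j - 1)) = m"
  proof (rule the_equality)
    show "1 \<le> m \<and> m \<le> length w \<and> b \<in> prefix_shape w m - prefix_shape w (m - 1)"
      using m least[of "m - 1"] \<open>m \<noteq> 0\<close> by auto
  next
    fix k
    assume k: "1 \<le> k \<and> k \<le> length w \<and> b \<in> prefix_shape w k - prefix_shape w (k - 1)"
    have "\<not> k < m"
      using k least by blast
    moreover have "\<not> m \<le> k - 1"
    proof
      assume "m \<le> k - 1"
      moreover have "k - 1 \<le> length w"
        using k by linarith
      ultimately show False
        using k m(1) prefix_shape_mono by blast
    qed
    ultimately show "k = m"
      by simp
  qed
  then have "Q_tableau w b = Some m"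
    using True by (simp add: Q_tableau_def)
  moreover have "b \<in> prefix_shape w t \<longleftrightarrow> m \<le> t"
    using m(1) least[of t] prefix_shape_mono[OF _ assms, of m] by (cases "m \<le> t") auto
  ultimately show ?thesis
    by simp
next
  case False
  then show ?thesis
    using prefix_shape_mono[OF assms order_refl] by (auto simp: Q_tableau_def)
qed

lemma length_row_at_eq:
  assumes "Q_tableau u = Q_tableau w" "length u = length w" "t \<le> length w"
  shows "length (row_at u r t) = length (row_at w r t)"
proof -
  have "(r, c) \<in> prefix_shape u t \<longleftrightarrow> (r, c) \<in> prefix_shape w t" for c
    using assms prefix_shape_Q_tableau[of t u "(r, c)"] prefix_shape_Q_tableau[of t w "(r, c)"]
    by simp
  \<comment> \<open>Taking each of the two lengths as the column \<open>c\<close> gives the two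
    inequalities between them.\<close>
  from this[of "length (row_at u r t)"] this[of "length (row_at w r t)"] show ?thesis
    by (simp add: prefix_shape_iff)
qed

text \<open>The left end \<open>i\<close> is generalised because growth at \<open>t\<close> refers
  to the row below on the shorter interval from \<open>Suc t\<close>; the right end \<open>j\<close>
  stays fixed.\<close>

lemma lds_inserted_words_eq:
  assumes A: "inserted_words u A" and B: "inserted_words w B" and len: "length u = length w"
    and rows: "\<And>r t. t \<le> length w \<Longrightarrow> length (row_at u r t) = length (row_at w r t)"
    and ij: "i \<le> j" "j \<le> length w"
  shows "lds (blocks (A r) i j) = lds (blocks (B r) i j)"
  using ij(1)
proof (induction "max (length (P_tableau u)) (length (P_tableau w)) - r" arbitrary: r i)
  case 0
  then show ?case
    using lds_inserted_words_empty[OF A] lds_inserted_words_empty[OF B] ij(2) len by simp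
next
  case (Suc k)
  have IH: "lds (blocks (A (Suc r)) i j) = lds (blocks (B (Suc r)) i j)" if "i \<le> j" for i
    using Suc that by simp
  have growth: "length (row_at u r (Suc t)) = length (row_at u r t) \<longleftrightarrow>
      length (row_at w r (Suc t)) = length (row_at w r t)" if "t < j" for t
    using that ij(2) rows by simp
  have ju: "j \<le> length u"
    using ij(2) len by simp
  let ?G = "\<lambda>t. i \<le> t \<and> t < j \<and> length (row_at w r (Suc t)) \<noteq> length (row_at w r t)"
  show ?case
  proof (cases "\<exists>t. ?G t")
    case False
    then have "lds (blocks (A r) i j) = lds (blocks (A (Suc r)) i j)"
      using growth by (intro lds_inserted_words_no_growth[OF A Suc.prems ju]) blast
    moreover have "lds (blocks (B r) i j) = lds (blocks (B (Suc r)) i j)"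
      using False by (intro lds_inserted_words_no_growth[OF B Suc.prems ij(2)]) blast
    ultimately show ?thesis
      using IH Suc.prems by simp
  next
    case True
    define t where "t = (LEAST t. ?G t)"
    have t: "?G t"
      unfolding t_def by (rule LeastI_ex[OF True])
    have least: "\<not> ?G s" if "s < t" for s
      using that unfolding t_def by (rule not_less_Least)
    have "lds (blocks (A r) i j) =
        max (lds (blocks (A (Suc r)) i j)) (Suc (lds (blocks (A (Suc r)) (Suc t) j)))"
    proof (rule lds_inserted_words_growth[OF A Suc.prems ju])
      show "length (row_at u r (Suc t)) \<noteq> length (row_at u r t)"
        using t growth by blast
      show "length (row_at u r (Suc s)) = length (row_at u r s)" if "i \<le> s" "s < t" for s
        using that t least[of s] growth[of s] by simp
    qed (use t in auto)
    moreover have "lds (blocks (B r) i j) =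
        max (lds (blocks (B (Suc r)) i j)) (Suc (lds (blocks (B (Suc r)) (Suc t) j)))"
    proof (rule lds_inserted_words_growth[OF B Suc.prems ij(2)])
      show "length (row_at w r (Suc s)) = length (row_at w r s)" if "i \<le> s" "s < t" for s
        using that t least[of s] by simp
    qed (use t in auto)
    ultimately show ?thesis
      using IH[OF Suc.prems] IH[of "Suc t"] t by simp
  qed
qed

text \<open>Row 0 may receive several copies of \<open>w ! t\<close>, enough to reach the column of
  the adjoined box; for \<open>lds\<close> such a block counts like the single letter.\<close>

lemma lds_drop_take:
  assumes "inserted_words w A" "j \<le> length w"
  shows "lds (drop i (take j w)) = lds (blocks (A 0) i j)"
proof -
  have "drop i (take j w) = blocks (\<lambda>t. [w ! t]) i j"
    using assms(2) unfolding blocks_def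
    by (intro nth_equalityI) (auto simp: concat_map_singleton)
  also have "lds \<dots> = lds (blocks (A 0) i j)"
    using inserted_wordsD(1,2)[OF assms(1)] assms(2) by (intro lds_blocks_cong) simp
  finally show ?thesis .
qed

theorem theorem4p17:
  fixes n :: nat and u w :: "nat list"
  assumes "u \<in> words n" and "w \<in> words n"
    and "Q_tableau u = Q_tableau w"
  shows "u \<sim>cd w"
proof -
  have len: "length u = length w"
    using assms(1,2) by (simp add: words_def)
  obtain A B where A: "inserted_words u A" and B: "inserted_words w B"
    using inserted_words_exist by blast
  \<comment> \<open>Letter number \<open>i\<close> is processed at step \<open>i - 1\<close>, so the
    factor from \<open>i\<close> to \<open>j\<close> corresponds to the half-open interval from
    \<open>i - 1\<close> to \<open>j\<close>.\<close>
  have "lds (drop (i - 1) (take j u)) = lds (drop (i - 1) (take j w))"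
    if "i \<le> j" "j \<le> length u" for i j
  proof -
    have "i - 1 \<le> j" "j \<le> length w"
      using that len by simp_all
    then show ?thesis
      unfolding lds_drop_take[OF A that(2)] lds_drop_take[OF B \<open>j \<le> length w\<close>]
      by (intro lds_inserted_words_eq[OF A B len length_row_at_eq[OF assms(3) len]])
  qed
  then show ?thesis
    using len by (simp add: cd_equiv_def factor_def)
qed

end
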